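(* Let $\mathbb{F}$ be either $\mathbb{R}$ or $\mathbb{C}$, and let $\mathcal{A}$ be a homotonic algebra over $\mathbb{F}$ of $\mathbb{F}$-valued functions defined on a set $\mathbf{T}$, with multiplication $\times$. Let $w$ be a fixed positive function on $\mathbf{T}$ (not necessarily in $\mathcal{A}$) such that the function $w_{-1}$, defined by $w_{-1}(t)=\frac{1}{w(t)}$ for all $t\in\mathbf{T}$, is an element of $\mathcal{A}$. Assume that $$\sup_{t\in\mathbf{T}}w(t)|f(t)|<\infty\quad\text{for all }f\in\mathcal{A}.$$ Then the weighted sup norm $$\Vert f\Vert_{w,\infty}=\sup_{t\in\mathbf{T}}w(t)|f(t)|,\quad f\in\mathcal{A},$$ is sub-multiplicative on $\mathcal{A}$ if and only if $$w_{-1}\times w_{-1}\le w_{-1}.$$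
   Context: An algebra $\mathcal{A}$ over $\mathbb{F}$ ($\mathbb{R}$ or $\mathbb{C}$) of $\mathbb{F}$-valued functions on a set $\mathbf{T}$ means a (finite or infinite dimensional) vector space over $\mathbb{F}$ of functions $\mathbf{T}\to\mathbb{F}$, with pointwise addition and scalar multiplication, equipped with an $\mathbb{F}$-bilinear multiplication $\times:\mathcal{A}\times\mathcal{A}\to\mathcal{A}$. The multiplication need not be pointwise, and is not assumed to be associative, commutative or unital. The functions are not assumed to be bounded. For $f\in\mathcal{A}$, $|f|$ is the function defined by $|f|(t)=|f(t)|$ for $t\in\mathbf{T}$. For real valued functions $f,g$ on $\mathbf{T}$, $f\le g$ means $f(t)\le g(t)$ for all $t\in\mathbf{T}$. (When $\mathbb{F}=\mathbb{C}$, writing an inequality between two functions includes the assertion that both functions are real valued.) $\mathcal{A}$ is called homotonic if: (i) $f\in\mathcal{A}$ implies $|f|\in\mathcal{A}$; and (ii) for any two elements $f,g\in\mathcal{A}$, $|f\times g|\le |f|\times|g|$. A norm $\Vert\cdot\Vert$ on $\mathcal{A}$ is called sub-multiplicative if $\Vert f\times g\Vert\le\Vert f\Vert\,\Vert g\Vert$ for all $f,g\in\mathcal{A}$. *)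

theory Defs
  imports Complex_Main "HOL-Library.Function_Algebras"
begin

text \<open>The set \<open>T\<close> is the type \<open>'t\<close>, so it is nonempty and its functions need no restriction to a
  carrier. Vector addition and zero of functions are the pointwise ones of
  \<^theory>\<open>HOL-Library.Function_Algebras\<close>; the multiplication of that theory plays no role, since
  the multiplication of an algebra is the parameter \<open>mult\<close>. It is only constrained on \<open>A\<close>.\<close>

definition fun_scale :: "'a::field \<Rightarrow> ('t \<Rightarrow> 'a) \<Rightarrow> 't \<Rightarrow> 'a" where
  "fun_scale c f = (\<lambda>t. c * f t)"

definition fun_abs :: "('t \<Rightarrow> 'a::real_normed_field) \<Rightarrow> 't \<Rightarrow> 'a" where
  "fun_abs f = (\<lambda>t. of_real (norm (f t)))"

text \<open>An inequality between scalar functions includes the assertion that both are real valued. In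
  particular this is not the order on complex numbers that only compares numbers with equal
  imaginary parts.\<close>

definition real_fun_le :: "('t \<Rightarrow> 'a::real_normed_field) \<Rightarrow> ('t \<Rightarrow> 'a) \<Rightarrow> bool" where
  "real_fun_le f g \<longleftrightarrow> (\<forall>t. \<exists>a b::real. f t = of_real a \<and> g t = of_real b \<and> a \<le> b)"

locale function_algebra =
  fixes A :: "('t \<Rightarrow> 'a::real_normed_field) set"
    and mult :: "('t \<Rightarrow> 'a) \<Rightarrow> ('t \<Rightarrow> 'a) \<Rightarrow> 't \<Rightarrow> 'a"
  assumes subspace: "module.subspace fun_scale A"
    and mult_closed: "f \<in> A \<Longrightarrow> g \<in> A \<Longrightarrow> mult f g \<in> A"
    and mult_add_left: "f \<in> A \<Longrightarrow> g \<in> A \<Longrightarrow> h \<in> A \<Longrightarrow> mult (f + g) h = mult f h + mult g h"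
    and mult_add_right: "f \<in> A \<Longrightarrow> g \<in> A \<Longrightarrow> h \<in> A \<Longrightarrow> mult f (g + h) = mult f g + mult f h"
    and mult_scale_left: "f \<in> A \<Longrightarrow> g \<in> A \<Longrightarrow> mult (fun_scale c f) g = fun_scale c (mult f g)"
    and mult_scale_right: "f \<in> A \<Longrightarrow> g \<in> A \<Longrightarrow> mult f (fun_scale c g) = fun_scale c (mult f g)"

locale homotonic_algebra = function_algebra +
  assumes abs_closed: "f \<in> A \<Longrightarrow> fun_abs f \<in> A"
    and abs_mult_le: "f \<in> A \<Longrightarrow> g \<in> A \<Longrightarrow>
      real_fun_le (fun_abs (mult f g)) (mult (fun_abs f) (fun_abs g))"

definition submultiplicative_on ::
    "'v set \<Rightarrow> ('v \<Rightarrow> 'v \<Rightarrow> 'v) \<Rightarrow> ('v \<Rightarrow> real) \<Rightarrow> bool" where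
  "submultiplicative_on A mult N \<longleftrightarrow> (\<forall>f\<in>A. \<forall>g\<in>A. N (mult f g) \<le> N f * N g)"

definition weight_recip :: "('t \<Rightarrow> real) \<Rightarrow> 't \<Rightarrow> 'a::real_normed_field" where
  "weight_recip w = (\<lambda>t. of_real (1 / w t))"

text \<open>The supremum is only meaningful for \<open>f\<close> such that \<open>w \<bar>f\<bar>\<close> is bounded.\<close>

definition weighted_sup_norm :: "('t \<Rightarrow> real) \<Rightarrow> ('t \<Rightarrow> 'a::real_normed_field) \<Rightarrow> real" where
  "weighted_sup_norm w f = (SUP t. w t * norm (f t))"

lemma module_fun_scale: "module (fun_scale :: 'a::field \<Rightarrow> ('t \<Rightarrow> 'a) \<Rightarrow> 't \<Rightarrow> 'a)"
  by unfold_locales (auto simp: fun_scale_def fun_eq_iff algebra_simps)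

end

theory Submission
  imports Defs
begin

text \<open>
  Write \<open>v\<close> for the reciprocal weight \<open>1 / w\<close>. For \<open>f \<in> A\<close>, the norm \<open>N f\<close> is the least real
  \<open>c\<close> with \<open>\<bar>f\<bar> \<le> c v\<close>, so \<open>v\<close> is the largest nonnegative function of norm \<open>1\<close>, and
  submultiplicativity only has to be tested at \<open>v\<close>.

  Homotonicity supplies the needed order structure: if \<open>f, g \<ge> 0\<close>, then
  \<open>f = \<bar>f\<bar>\<close> and \<open>g = \<bar>g\<bar>\<close>, so \<open>\<bar>f \<times> g\<bar> \<le> f \<times> g\<close>, which forces \<open>f \<times> g \<ge> 0\<close>
  (\<open>mult_nonneg\<close>). By bilinearity \<open>\<times>\<close> is then monotone on nonnegative functions
  (\<open>mult_mono_nonneg\<close>). Hence if \<open>v \<times> v \<le> v\<close>,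
  \<open>\<bar>f \<times> g\<bar> \<le> \<bar>f\<bar> \<times> \<bar>g\<bar> \<le> (N f * v) \<times> (N g * v) = N f * N g * (v \<times> v) \<le> N f * N g * v\<close>,
  which says \<open>N (f \<times> g) \<le> N f * N g\<close>. Conversely, \<open>N v = 1\<close> and submultiplicativity give
  \<open>\<bar>v \<times> v\<bar> \<le> v\<close>; as \<open>v \<times> v \<ge> 0\<close>, the bars can be dropped.

  The argument is the same for both scalar fields and is carried out over an arbitrary real
  normed field.
\<close>

lemma real_fun_leD:
  assumes "real_fun_le f g"
  obtains a b where "f t = of_real a" "g t = of_real b" "a \<le> b"
  using assms unfolding real_fun_le_def by blast

lemma nonneg_funD:
  fixes f :: "'t \<Rightarrow> 'a::real_normed_field"
  assumes "real_fun_le 0 f"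
  obtains b where "f t = of_real b" "0 \<le> b"
proof -
  obtain a b where "(0 :: 't \<Rightarrow> 'a) t = of_real a" "f t = of_real b" "a \<le> b"
    using assms by (rule real_fun_leD)
  then show thesis
    using that[of b] by simp
qed

lemma real_fun_le_trans [trans]:
  assumes "real_fun_le f g" and "real_fun_le g h"
  shows "real_fun_le f h"
  unfolding real_fun_le_def
proof
  fix t
  obtain a b where ab: "f t = of_real a" "g t = of_real b" "a \<le> b"
    using assms(1) by (rule real_fun_leD)
  obtain b' c where bc: "g t = of_real b'" "h t = of_real c" "b' \<le> c"
    using assms(2) by (rule real_fun_leD)
  have "b = b'"
    using ab(2) bc(1) by simp
  then show "\<exists>a c. f t = of_real a \<and> h t = of_real c \<and> a \<le> c"
    using ab bc by (intro exI[of _ a] exI[of _ c]) auto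
qed

lemma real_fun_le_if_diff_nonneg:
  assumes "real_fun_le 0 f" and "real_fun_le 0 (g - f)"
  shows "real_fun_le f g"
  unfolding real_fun_le_def
proof
  fix t
  obtain a where "f t = of_real a"
    using assms(1) by (rule nonneg_funD)
  obtain b where "(g - f) t = of_real b" "0 \<le> b"
    using assms(2) by (rule nonneg_funD)
  then have "g t = of_real (a + b)"
    using \<open>f t = of_real a\<close> by (simp add: algebra_simps)
  then show "\<exists>a b. f t = of_real a \<and> g t = of_real b \<and> a \<le> b"
    using \<open>f t = of_real a\<close> \<open>0 \<le> b\<close> by (intro exI[of _ a] exI[of _ "a + b"]) auto
qed

lemma real_fun_le_diff_nonneg:
  assumes "real_fun_le f g"
  shows "real_fun_le 0 (g - f)"
  unfolding real_fun_le_def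
proof
  fix t
  obtain a b where "f t = of_real a" "g t = of_real b" "a \<le> b"
    using assms by (rule real_fun_leD)
  then show "\<exists>x y. (0 :: _ \<Rightarrow> _) t = of_real x \<and> (g - f) t = of_real y \<and> x \<le> y"
    by (intro exI[of _ 0] exI[of _ "b - a"]) auto
qed

lemma real_fun_le_scale:
  assumes "real_fun_le f g" and "0 \<le> c"
  shows "real_fun_le (fun_scale (of_real c) f) (fun_scale (of_real c) g)"
  unfolding real_fun_le_def
proof
  fix t
  obtain a b where "f t = of_real a" "g t = of_real b" "a \<le> b"
    using assms(1) by (rule real_fun_leD)
  then show "\<exists>x y. fun_scale (of_real c) f t = of_real x \<and>
      fun_scale (of_real c) g t = of_real y \<and> x \<le> y"
    using \<open>0 \<le> c\<close>
    by (intro exI[of _ "c * a"] exI[of _ "c * b"]) (auto simp: fun_scale_def mult_left_mono)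
qed

lemma fun_abs_nonneg: "real_fun_le 0 (fun_abs f)"
  unfolding real_fun_le_def
proof
  fix t
  show "\<exists>a b. (0 :: _ \<Rightarrow> _) t = of_real a \<and> fun_abs f t = of_real b \<and> a \<le> b"
    by (intro exI[of _ 0] exI[of _ "norm (f t)"]) (simp add: fun_abs_def)
qed

lemma fun_abs_eq_self:
  assumes "real_fun_le 0 f"
  shows "fun_abs f = f"
proof
  fix t
  obtain b where "f t = of_real b" "0 \<le> b"
    using assms by (rule nonneg_funD)
  then show "fun_abs f t = f t"
    by (simp add: fun_abs_def)
qed

text \<open>\<open>\<bar>f\<bar> \<le> g\<close> makes \<open>g\<close> real valued and bounds it below by a nonnegative function.\<close>

lemma nonneg_of_fun_abs_le:
  "real_fun_le (fun_abs f) g \<Longrightarrow> real_fun_le 0 g"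
  using fun_abs_nonneg real_fun_le_trans by blast

lemma real_fun_le_fun_abs_iff:
  "real_fun_le (fun_abs f) (\<lambda>t. of_real (h t)) \<longleftrightarrow> (\<forall>t. norm (f t) \<le> h t)"
  by (auto simp: real_fun_le_def fun_abs_def)

lemma weight_recip_nonneg:
  assumes "\<And>t. 0 < w t"
  shows "real_fun_le 0 (weight_recip w)"
  unfolding real_fun_le_def
proof
  fix t
  show "\<exists>a b. (0 :: _ \<Rightarrow> _) t = of_real a \<and> weight_recip w t = of_real b \<and> a \<le> b"
    using less_imp_le[OF assms[of t]]
    by (intro exI[of _ 0] exI[of _ "1 / w t"]) (auto simp: weight_recip_def)
qed

lemma weighted_sup_norm_weight_recip:
  assumes "\<And>t. 0 < w t"
  shows "weighted_sup_norm w (weight_recip w :: 't \<Rightarrow> 'a::real_normed_field) = 1"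
proof -
  have "w t * norm (weight_recip w t :: 'a) = 1" for t
    using assms[of t] by (simp add: weight_recip_def norm_divide)
  then show ?thesis
    by (simp add: weighted_sup_norm_def)
qed

text \<open>This turns each norm estimate below into an inequality between functions.\<close>

lemma weighted_sup_norm_le_iff:
  assumes w_pos: "\<And>t. 0 < w t"
    and bdd: "bdd_above (range (\<lambda>t. w t * norm (f t)))"
  shows "weighted_sup_norm w f \<le> c \<longleftrightarrow>
         real_fun_le (fun_abs f) (fun_scale (of_real c) (weight_recip w))"
proof -
  have "weighted_sup_norm w f \<le> c \<longleftrightarrow> (\<forall>t. w t * norm (f t) \<le> c)"
    unfolding weighted_sup_norm_def using bdd by (subst cSUP_le_iff) auto
  also have "\<dots> \<longleftrightarrow> (\<forall>t. norm (f t) \<le> c * (1 / w t))"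
    using w_pos by (simp add: pos_le_divide_eq mult.commute)
  also have "\<dots> \<longleftrightarrow> real_fun_le (fun_abs f) (\<lambda>t. of_real (c * (1 / w t)))"
    by (rule real_fun_le_fun_abs_iff[symmetric])
  also have "(\<lambda>t. of_real (c * (1 / w t))) = fun_scale (of_real c) (weight_recip w)"
    by (simp add: fun_scale_def weight_recip_def fun_eq_iff)
  finally show ?thesis .
qed

lemma weighted_sup_norm_nonneg:
  assumes w_pos: "\<And>t. 0 < w t"
    and bdd: "bdd_above (range (\<lambda>t. w t * norm (f t)))"
  shows "0 \<le> weighted_sup_norm w f"
proof -
  \<comment> \<open>Any point of the (nonempty) domain would do.\<close>
  have "0 \<le> w undefined * norm (f undefined)"
    using w_pos[of undefined] by simp
  also have "\<dots> \<le> weighted_sup_norm w f"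
    unfolding weighted_sup_norm_def using bdd by (intro cSUP_upper) auto
  finally show ?thesis .
qed

context function_algebra
begin

lemma scale_closed: "f \<in> A \<Longrightarrow> fun_scale c f \<in> A"
  using subspace by (simp add: module.subspace_def[OF module_fun_scale])

lemma diff_closed: "f \<in> A \<Longrightarrow> g \<in> A \<Longrightarrow> f - g \<in> A"
  using module.subspace_diff[OF module_fun_scale subspace] .

lemma mult_diff_left:
  assumes "f \<in> A" "g \<in> A" "h \<in> A"
  shows "mult (f - g) h = mult f h - mult g h"
  using mult_add_left[of "f - g" g h] assms by (simp add: diff_closed algebra_simps)

lemma mult_diff_right:
  assumes "f \<in> A" "g \<in> A" "h \<in> A"
  shows "mult f (g - h) = mult f g - mult f h"
  using mult_add_right[of f "g - h" h] assms by (simp add: diff_closed algebra_simps)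

end

context homotonic_algebra
begin

lemma mult_nonneg:
  assumes "f \<in> A" "g \<in> A" "real_fun_le 0 f" "real_fun_le 0 g"
  shows "real_fun_le 0 (mult f g)"
  using abs_mult_le[of f g] assms by (auto simp: fun_abs_eq_self intro: nonneg_of_fun_abs_le)

text \<open>Change one factor at a time, first \<open>f\<close> to \<open>f'\<close> and then \<open>g\<close> to \<open>g'\<close>: each time the
  difference is a product of nonnegative elements.\<close>

lemma mult_mono_nonneg:
  assumes A: "f \<in> A" "f' \<in> A" "g \<in> A" "g' \<in> A"
    and nonneg: "real_fun_le 0 f" "real_fun_le 0 g"
    and le: "real_fun_le f f'" "real_fun_le g g'"
  shows "real_fun_le (mult f g) (mult f' g')"
proof -
  have f': "real_fun_le 0 f'"
    using nonneg(1) le(1) by (rule real_fun_le_trans)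
  have "real_fun_le 0 (mult f' g - mult f g)"
    using mult_nonneg[of "f' - f" g] A nonneg le
    by (simp add: mult_diff_left diff_closed real_fun_le_diff_nonneg)
  then have "real_fun_le (mult f g) (mult f' g)"
    using A nonneg by (metis real_fun_le_if_diff_nonneg mult_nonneg)
  moreover have "real_fun_le 0 (mult f' g' - mult f' g)"
    using mult_nonneg[of f' "g' - g"] A f' le
    by (simp add: mult_diff_right diff_closed real_fun_le_diff_nonneg)
  then have "real_fun_le (mult f' g) (mult f' g')"
    using A nonneg f' by (metis real_fun_le_if_diff_nonneg mult_nonneg)
  ultimately show ?thesis
    by (rule real_fun_le_trans)
qed

theorem submultiplicative_weighted_sup_norm_iff:
  assumes w_pos: "\<And>t. 0 < w t"
    and v: "weight_recip w \<in> A"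
    and bdd: "\<And>f. f \<in> A \<Longrightarrow> bdd_above (range (\<lambda>t. w t * norm (f t)))"
  shows "submultiplicative_on A mult (weighted_sup_norm w) \<longleftrightarrow>
         real_fun_le (mult (weight_recip w) (weight_recip w)) (weight_recip w)"
    (is "?submult \<longleftrightarrow> real_fun_le (mult ?v ?v) ?v")
proof -
  let ?N = "weighted_sup_norm w"
  note norm_le_iff = weighted_sup_norm_le_iff[where w = w, OF w_pos bdd]
  note v_nonneg = weight_recip_nonneg[where w = w, OF w_pos]
  have "real_fun_le (mult ?v ?v) ?v" if ?submult
  proof -
    from that have "?N (mult ?v ?v) \<le> 1"
      using v unfolding submultiplicative_on_def
      by (force simp: weighted_sup_norm_weight_recip[where w = w, OF w_pos])
    then have "real_fun_le (fun_abs (mult ?v ?v)) (fun_scale (of_real 1) ?v)"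
      using norm_le_iff[OF mult_closed[OF v v]] by blast
    then show ?thesis
      using fun_abs_eq_self[OF mult_nonneg[OF v v v_nonneg v_nonneg]]
      by (simp add: fun_scale_def)
  qed
  moreover have ?submult if vv: "real_fun_le (mult ?v ?v) ?v"
    unfolding submultiplicative_on_def
  proof (intro ballI)
    fix f g
    assume f: "f \<in> A" and g: "g \<in> A"
    define Nf Ng where "Nf = ?N f" and "Ng = ?N g"
    let ?f = "fun_scale (of_real Nf) ?v" and ?g = "fun_scale (of_real Ng) ?v"
    have nonneg: "0 \<le> Nf" "0 \<le> Ng"
      unfolding Nf_def Ng_def using weighted_sup_norm_nonneg[where w = w, OF w_pos bdd] f g
      by auto
    have le: "real_fun_le (fun_abs f) ?f" "real_fun_le (fun_abs g) ?g"
      unfolding Nf_def Ng_def using norm_le_iff f g by blast+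
    have "real_fun_le (fun_abs (mult f g)) (mult (fun_abs f) (fun_abs g))"
      using f g by (rule abs_mult_le)
    also have "real_fun_le (mult (fun_abs f) (fun_abs g)) (mult ?f ?g)"
      using f g v le by (intro mult_mono_nonneg abs_closed scale_closed fun_abs_nonneg)
    also have "mult ?f ?g = fun_scale (of_real (Nf * Ng)) (mult ?v ?v)"
      using v by (simp add: mult_scale_left mult_scale_right scale_closed)
        (simp add: fun_scale_def mult_ac)
    also have "real_fun_le \<dots> (fun_scale (of_real (Nf * Ng)) ?v)"
      using vv nonneg by (intro real_fun_le_scale) auto
    finally have "real_fun_le (fun_abs (mult f g)) (fun_scale (of_real (Nf * Ng)) ?v)" .
    then show "?N (mult f g) \<le> ?N f * ?N g"
      using norm_le_iff[OF mult_closed[OF f g]] unfolding Nf_def Ng_def by blast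
  qed
  ultimately show ?thesis
    by blast
qed

end

theorem theorem3p1:
  fixes w :: "'t \<Rightarrow> real"
  assumes w_pos: "\<And>t. 0 < w t"
  shows "(\<forall>(A :: ('t \<Rightarrow> real) set) mult.
            homotonic_algebra A mult \<longrightarrow>
            weight_recip w \<in> A \<longrightarrow>
            (\<forall>f\<in>A. bdd_above (range (\<lambda>t. w t * norm (f t)))) \<longrightarrow>
            (submultiplicative_on A mult (weighted_sup_norm w) \<longleftrightarrow>
             real_fun_le (mult (weight_recip w) (weight_recip w)) (weight_recip w))) \<and>
         (\<forall>(A :: ('t \<Rightarrow> complex) set) mult.
            homotonic_algebra A mult \<longrightarrow>
            weight_recip w \<in> A \<longrightarrow>
            (\<forall>f\<in>A. bdd_above (range (\<lambda>t. w t * norm (f t)))) \<longrightarrow>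
            (submultiplicative_on A mult (weighted_sup_norm w) \<longleftrightarrow>
             real_fun_le (mult (weight_recip w) (weight_recip w)) (weight_recip w)))"
  by (intro conjI allI impI homotonic_algebra.submultiplicative_weighted_sup_norm_iff)
    (auto intro: w_pos)

end
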